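(* Let $X$ be a locale whose frame is given by a $\mathbf{Sup}$-type presentation $\mathcal{O}X = \langle G \text{ } \wedge\text{-semilattice} \mid R\rangle_{\mathbf{Frm}}$, and let $q\colon X \twoheadrightarrow Y$ be an open quotient. For each $t\in G$ fix a representation $q^*q_!(t) = \bigvee_{\beta} t_\beta$ in $\mathcal{O}X$ with all $t_\beta \in G$. Then $$\mathcal{O}Y \cong \langle \Diamond g,\ g \in G \mid R,\ \Diamond 1 = 1,\ \Diamond s \wedge \Diamond t = \Diamond(s \wedge q^*q_!(t)),\ s,t \in G\rangle_{\mathbf{Frm}},$$ where $\Diamond(s\wedge q^*q_!(t))$ stands for $\bigvee_{\beta} \Diamond(s \wedge t_\beta)$ for the fixed representation $q^*q_!(t)=\bigvee_\beta t_\beta$ (with $s\wedge t_\beta$ computed in $G$), and each relation $\bigvee A \le \bigvee B$ of $R$ is read as $\bigvee_{a\in A}\Diamond a \le \bigvee_{b\in B}\Diamond b$. (Here the generators $\Diamond g$ are just a set indexed by $G$.)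
   Context: For a locale $X$, $\mathcal{O}X$ denotes its frame; a locale map $f\colon X\to Y$ corresponds to a frame homomorphism $f^*\colon\mathcal{O}Y\to\mathcal{O}X$. $f$ is open if $f^*$ has a left adjoint $f_!\colon \mathcal{O}X\to\mathcal{O}Y$ satisfying $f_!(a\wedge f^*(b)) = f_!(a)\wedge b$; an open quotient is an epic (i.e. $f^*$ injective) open map. $\langle G\mid R\rangle_{\mathbf{Frm}}$ denotes the frame presented by generators $G$ and relations $R$ (formal equalities and inequalities between elements of the free frame on $G$); "$G$ $\wedge$-semilattice" means the free frame on the $\wedge$-semilattice $G$ is used (equivalently, relations are added forcing finite meets, including the top $1$, to agree with those in $G$). Semilattices are unital. A presentation $\langle G \text{ }\wedge\text{-semilattice}\mid R\rangle_{\mathbf{Frm}}$ is $\mathbf{Sup}$-type if every relation in $R$ has the form $\bigvee A\le\bigvee B$ with $A,B\subseteq G$, and whenever $\bigvee A\le \bigvee B$ is in $R$, so is $\bigvee_{a\in A} (a\wedge c) \le \bigvee_{b\in B} (b\wedge c)$ for each $c\in G$. *)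

theory Defs
  imports Main "HOL-Library.FSet"
begin

text \<open>
  The class \<^class>\<open>complete_distrib_lattice\<close> requires complete distributivity, which is
  strictly stronger than the frame law. A locale \<open>X\<close> is represented by the type carrying its
  frame, and a locale map by the corresponding frame homomorphism in the opposite direction.
\<close>

class frame = complete_lattice +
  assumes frame_inf_Sup: "inf a (Sup B) = Sup (inf a ` B)"

definition frame_hom :: "('a::frame \<Rightarrow> 'b::frame) \<Rightarrow> bool" where
  "frame_hom h \<longleftrightarrow>
     h top = top \<and> (\<forall>a b. h (inf a b) = inf (h a) (h b)) \<and> (\<forall>A. h (Sup A) = Sup (h ` A))"

definition left_adjoint :: "('a::order \<Rightarrow> 'b::order) \<Rightarrow> ('b \<Rightarrow> 'a) \<Rightarrow> bool" where
  "left_adjoint l r \<longleftrightarrow> (\<forall>a b. l a \<le> b \<longleftrightarrow> a \<le> r b)"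

definition open_map :: "('y::frame \<Rightarrow> 'x::frame) \<Rightarrow> ('x \<Rightarrow> 'y) \<Rightarrow> bool" where
  "open_map f_star f_shriek \<longleftrightarrow>
     frame_hom f_star \<and> left_adjoint f_shriek f_star \<and>
     (\<forall>a b. f_shriek (inf a (f_star b)) = inf (f_shriek a) b)"

definition open_quotient :: "('y::frame \<Rightarrow> 'x::frame) \<Rightarrow> ('x \<Rightarrow> 'y) \<Rightarrow> bool" where
  "open_quotient q_star q_shriek \<longleftrightarrow> open_map q_star q_shriek \<and> inj q_star"

text \<open>
  The free \<open>\<and>\<close>-semilattice on a set is the set of its finite subsets ordered by reverse
  inclusion, and the free frame is the frame of down-sets of this semilattice. Hence the sets
  below are closed under taking finite supersets.
\<close>

typedef 'g free_frame = "{U :: 'g fset set. \<forall>A\<in>U. \<forall>B. A |\<subseteq>| B \<longrightarrow> B \<in> U}"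
  morphisms downset Free
  by auto

setup_lifting type_definition_free_frame

instantiation free_frame :: (type) frame
begin

lift_definition less_eq_free_frame :: "'a free_frame \<Rightarrow> 'a free_frame \<Rightarrow> bool" is "(\<subseteq>)" .
lift_definition less_free_frame :: "'a free_frame \<Rightarrow> 'a free_frame \<Rightarrow> bool" is "(\<subset>)" .
lift_definition inf_free_frame :: "'a free_frame \<Rightarrow> 'a free_frame \<Rightarrow> 'a free_frame" is "(\<inter>)"
  by blast
lift_definition sup_free_frame :: "'a free_frame \<Rightarrow> 'a free_frame \<Rightarrow> 'a free_frame" is "(\<union>)"
  by blast
lift_definition bot_free_frame :: "'a free_frame" is "{}" by blast
lift_definition top_free_frame :: "'a free_frame" is "UNIV" by blast
lift_definition Inf_free_frame :: "'a free_frame set \<Rightarrow> 'a free_frame" is "\<lambda>S. \<Inter>S" by blast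
lift_definition Sup_free_frame :: "'a free_frame set \<Rightarrow> 'a free_frame" is "\<lambda>S. \<Union>S" by blast

instance
  by standard
    (auto simp: less_eq_free_frame.rep_eq less_free_frame.rep_eq inf_free_frame.rep_eq
      sup_free_frame.rep_eq bot_free_frame.rep_eq top_free_frame.rep_eq Inf_free_frame.rep_eq
      Sup_free_frame.rep_eq simp flip: downset_inject)

end

lift_definition gen :: "'g \<Rightarrow> 'g free_frame" is "\<lambda>g. {A. g |\<in>| A}"
  by blast

definition extend :: "('g \<Rightarrow> 'l::frame) \<Rightarrow> 'g free_frame \<Rightarrow> 'l" where
  "extend f u = (SUP A \<in> downset u. INF g \<in> fset A. f g)"

lemma downset_simps:
  "downset (inf u v) = downset u \<inter> downset v"
  "downset (Sup S) = (\<Union>u\<in>S. downset u)"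
  "downset top = UNIV"
  "downset (gen g) = {A. g |\<in>| A}"
  by (simp_all add: inf_free_frame.rep_eq Sup_free_frame.rep_eq top_free_frame.rep_eq gen.rep_eq)

lemma downset_mono: "A \<in> downset u \<Longrightarrow> A |\<subseteq>| B \<Longrightarrow> B \<in> downset u"
  using downset[of u] by blast

lemma frame_SUP_inf_SUP:
  "inf (SUP a\<in>A. f a) (SUP b\<in>B. g b) = (SUP a\<in>A. SUP b\<in>B. inf (f a) (g b :: 'l::frame))"
proof -
  have *: "inf c (SUP b\<in>B. g b) = (SUP b\<in>B. inf c (g b))" for c and g :: "'z \<Rightarrow> 'l" and B
    by (simp add: frame_inf_Sup image_image)
  have "inf (SUP a\<in>A. f a) (SUP b\<in>B. g b) = (SUP a\<in>A. inf (SUP b\<in>B. g b) (f a))"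
    by (subst inf.commute) (rule *)
  also have "\<dots> = (SUP a\<in>A. SUP b\<in>B. inf (f a) (g b))"
    by (subst inf.commute) (simp only: *)
  finally show ?thesis .
qed

lemma frame_hom_comp: "frame_hom h \<Longrightarrow> frame_hom k \<Longrightarrow> frame_hom (k \<circ> h)"
  unfolding frame_hom_def by (simp add: image_comp)

lemma frame_hom_extend: "frame_hom (extend f)"
  unfolding frame_hom_def
proof (intro conjI allI)
  have "(INF g \<in> fset {||}. f g) \<le> extend f top"
    unfolding extend_def downset_simps by (rule SUP_upper) simp
  then show "extend f top = top" by (simp add: top_unique)
next
  fix u v
  let ?I = "\<lambda>A. INF g \<in> fset A. f g"
  have "extend f (inf u v) \<le> inf (extend f u) (extend f v)"
    unfolding extend_def downset_simps by (auto intro!: SUP_mono)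
  moreover have "inf (?I A) (?I B) \<le> extend f (inf u v)"
    if "A \<in> downset u" "B \<in> downset v" for A B
  proof -
    have "inf (?I A) (?I B) = ?I (A |\<union>| B)" by (simp add: INF_union)
    also have "\<dots> \<le> extend f (inf u v)"
      unfolding extend_def downset_simps using that
      by (intro SUP_upper) (auto intro: downset_mono)
    finally show ?thesis .
  qed
  then have "inf (extend f u) (extend f v) \<le> extend f (inf u v)"
    unfolding extend_def[of f u] extend_def[of f v] frame_SUP_inf_SUP by (auto intro!: SUP_least)
  ultimately show "extend f (inf u v) = inf (extend f u) (extend f v)" by (rule order.antisym)
next
  fix S
  show "extend f (Sup S) = Sup (extend f ` S)"
    unfolding extend_def downset_simps by (simp add: SUP_UNION)
qed

lemma extend_gen: "extend f (gen g) = f g"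
proof (rule order.antisym)
  show "extend f (gen g) \<le> f g"
    unfolding extend_def downset_simps by (rule SUP_least) (simp add: INF_lower)
  have "(INF g \<in> fset {|g|}. f g) \<le> extend f (gen g)"
    unfolding extend_def downset_simps by (rule SUP_upper) simp
  then show "f g \<le> extend f (gen g)" by simp
qed

lemma free_frame_normal_form: "u = (SUP A \<in> downset u. INF g \<in> fset A. gen g)"
proof -
  have *: "B \<in> downset (INF g \<in> fset A. gen g) \<longleftrightarrow> A |\<subseteq>| B" for A B :: "'a fset"
    by (auto simp: Inf_free_frame.rep_eq gen.rep_eq)
  have "downset u = downset (SUP A \<in> downset u. INF g \<in> fset A. gen g)"
    unfolding downset_simps by (auto simp: * intro: downset_mono)
  then show ?thesis by (simp add: downset_inject)
qed

lemma frame_hom_finite_INF: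
  assumes "frame_hom h" "finite A"
  shows "h (INF g \<in> A. f g) = (INF g \<in> A. h (f g))"
  using assms(2) by induction (use assms(1) in \<open>auto simp: frame_hom_def\<close>)

lemma extend_unique:
  assumes h: "frame_hom h" and f: "\<And>g. h (gen g) = f g"
  shows "h = extend f"
proof
  fix u
  have "h u = h (SUP A \<in> downset u. INF g \<in> fset A. gen g)"
    using free_frame_normal_form[of u] by simp
  also have "\<dots> = (SUP A \<in> downset u. h (INF g \<in> fset A. gen g))"
    using h by (simp add: frame_hom_def image_image)
  also have "\<dots> = extend f u"
    by (simp add: frame_hom_finite_INF[OF h] extend_def f)
  finally show "h u = extend f u" .
qed

theorem free_frame_universal: "\<exists>!h. frame_hom h \<and> (\<forall>g. h (gen g) = (f g :: 'l::frame))"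
  by (rule ex1I[of _ "extend f"]) (simp add: frame_hom_extend extend_gen, rule extend_unique, auto)

datatype 'a formal_relation = Equal 'a 'a | Below 'a 'a

definition frame_congruence :: "('a::frame \<times> 'a) set \<Rightarrow> bool" where
  "frame_congruence E \<longleftrightarrow>
     equiv UNIV E \<and>
     (\<forall>a b c d. (a, b) \<in> E \<longrightarrow> (c, d) \<in> E \<longrightarrow> (inf a c, inf b d) \<in> E) \<and>
     (\<forall>P \<subseteq> E. (Sup (fst ` P), Sup (snd ` P)) \<in> E)"

text \<open>In the quotient by \<open>E\<close>, the inequality \<open>[a] \<le> [b]\<close> means \<open>[a \<and> b] = [a]\<close>.\<close>

fun imposes :: "('a::frame \<times> 'a) set \<Rightarrow> 'a formal_relation \<Rightarrow> bool" where
  "imposes E (Equal a b) \<longleftrightarrow> (a, b) \<in> E"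
| "imposes E (Below a b) \<longleftrightarrow> (inf a b, a) \<in> E"

definition generated_congruence :: "'a::frame formal_relation set \<Rightarrow> ('a \<times> 'a) set" where
  "generated_congruence R = \<Inter>{E. frame_congruence E \<and> (\<forall>r\<in>R. imposes E r)}"

definition presented_frame :: "'g free_frame formal_relation set \<Rightarrow> 'g free_frame set set" where
  "presented_frame R = UNIV // generated_congruence R"

definition proj :: "'g free_frame formal_relation set \<Rightarrow> 'g free_frame \<Rightarrow> 'g free_frame set" where
  "proj R u = generated_congruence R `` {u}"

definition generator :: "'g free_frame formal_relation set \<Rightarrow> 'g \<Rightarrow> 'g free_frame set" where
  "generator R g = proj R (gen g)"

text \<open>
  The frame operations of the quotient are the unique
  ones making \<^term>\<open>proj R\<close> a frame homomorphism, so a map out of the quotient is a frame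
  homomorphism iff its composite with the projection is one.
\<close>

definition presentation_iso ::
  "'g free_frame formal_relation set \<Rightarrow> ('g free_frame set \<Rightarrow> 'l::frame) \<Rightarrow> bool" where
  "presentation_iso R \<phi> \<longleftrightarrow>
     bij_betw \<phi> (presented_frame R) UNIV \<and> frame_hom (\<phi> \<circ> proj R)"

lemma frame_congruence_generated: "frame_congruence (generated_congruence R)"
proof -
  let ?C = "{E. frame_congruence E \<and> (\<forall>r\<in>R. imposes E r)}"
  have C: "refl E \<and> sym E \<and> trans E" if "E \<in> ?C" for E
    using that by (simp add: frame_congruence_def equiv_def)
  have "refl (\<Inter>?C)" using C by (auto simp: refl_on_def)
  moreover have "sym (\<Inter>?C)"
  proof (rule symI, rule InterI)
    fix a b E assume "(a, b) \<in> \<Inter>?C" and E: "E \<in> ?C"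
    then have "(a, b) \<in> E" by blast
    then show "(b, a) \<in> E" using C[OF E] by (blast dest: symD)
  qed
  moreover have "trans (\<Inter>?C)"
  proof (rule transI, rule InterI)
    fix a b c E assume "(a, b) \<in> \<Inter>?C" "(b, c) \<in> \<Inter>?C" and E: "E \<in> ?C"
    then have "(a, b) \<in> E" "(b, c) \<in> E" by blast+
    then show "(a, c) \<in> E" using C[OF E] by (blast dest: transD)
  qed
  ultimately have "equiv UNIV (\<Inter>?C)" by (intro equivI) simp_all
  moreover have "(inf a c, inf b d) \<in> \<Inter>?C" if "(a, b) \<in> \<Inter>?C" "(c, d) \<in> \<Inter>?C" for a b c d
  proof
    fix E assume E: "E \<in> ?C"
    then have "(a, b) \<in> E" "(c, d) \<in> E" using that by blast+
    with E show "(inf a c, inf b d) \<in> E" by (simp add: frame_congruence_def)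
  qed
  moreover have "(Sup (fst ` P), Sup (snd ` P)) \<in> \<Inter>?C" if "P \<subseteq> \<Inter>?C" for P
  proof
    fix E assume E: "E \<in> ?C"
    then have "P \<subseteq> E" using that by blast
    with E show "(Sup (fst ` P), Sup (snd ` P)) \<in> E" by (simp add: frame_congruence_def)
  qed
  ultimately show ?thesis
    unfolding generated_congruence_def frame_congruence_def[of "\<Inter>?C"] by (intro conjI allI impI)
qed

lemma imposes_generated: "r \<in> R \<Longrightarrow> imposes (generated_congruence R) r"
  by (cases r) (simp_all add: generated_congruence_def, (metis imposes.simps)+)

lemma generated_congruence_least:
  "frame_congruence E \<Longrightarrow> (\<And>r. r \<in> R \<Longrightarrow> imposes E r) \<Longrightarrow> generated_congruence R \<subseteq> E"
  unfolding generated_congruence_def by blast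

lemma proj_eq_iff: "proj R u = proj R v \<longleftrightarrow> (u, v) \<in> generated_congruence R"
  using frame_congruence_generated[of R] unfolding frame_congruence_def proj_def
  by (metis UNIV_I eq_equiv_class_iff)

lemma frame_congruence_kernel:
  assumes "frame_hom h" shows "frame_congruence {(u, v). h u = h v}"
proof -
  let ?E = "{(u, v). h u = h v}"
  have "equiv UNIV ?E" by (rule equivI) (auto simp: refl_on_def sym_on_def trans_on_def)
  moreover have "(inf a c, inf b d) \<in> ?E" if "(a, b) \<in> ?E" "(c, d) \<in> ?E" for a b c d
    using that assms by (simp add: frame_hom_def)
  moreover have "(Sup (fst ` P), Sup (snd ` P)) \<in> ?E" if "P \<subseteq> ?E" for P
  proof -
    have "h ` fst ` P = h ` snd ` P"
      unfolding image_image by (rule image_cong) (use that in auto)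
    then show ?thesis using assms by (simp add: frame_hom_def)
  qed
  ultimately show ?thesis unfolding frame_congruence_def by blast
qed

fun satisfies :: "('g \<Rightarrow> 'l::frame) \<Rightarrow> 'g free_frame formal_relation \<Rightarrow> bool" where
  "satisfies f (Equal a b) \<longleftrightarrow> extend f a = extend f b"
| "satisfies f (Below a b) \<longleftrightarrow> extend f a \<le> extend f b"

text \<open>
  A frame isomorphic to \<^const>\<open>presented_frame\<close> has the universal property of the presentation
  with respect to frames on all types.
\<close>

theorem presentation_satisfies:
  assumes "presentation_iso R \<phi>" "r \<in> R"
  shows "satisfies (\<lambda>g. \<phi> (generator R g)) r"
proof -
  have hom: "frame_hom (\<phi> \<circ> proj R)" using assms(1) by (simp add: presentation_iso_def)
  have ext: "extend (\<lambda>g. \<phi> (generator R g)) = \<phi> \<circ> proj R"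
    by (rule extend_unique[symmetric]) (simp_all add: hom generator_def)
  show ?thesis
  proof (cases r)
    case (Equal a b)
    then show ?thesis using imposes_generated[OF assms(2)] by (simp add: ext flip: proj_eq_iff)
  next
    case (Below a b)
    then have "proj R (inf a b) = proj R a"
      using imposes_generated[OF assms(2)] by (simp add: proj_eq_iff)
    then have "inf (\<phi> (proj R a)) (\<phi> (proj R b)) = \<phi> (proj R a)"
      using hom unfolding frame_hom_def comp_def by metis
    then show ?thesis unfolding Below satisfies.simps ext comp_def by (simp only: inf.absorb_iff1)
  qed
qed

theorem presentation_universal:
  fixes f :: "'g \<Rightarrow> 'm::frame" and \<phi> :: "'g free_frame set \<Rightarrow> 'l::frame"
  assumes iso: "presentation_iso R \<phi>" and f: "\<And>r. r \<in> R \<Longrightarrow> satisfies f r"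
  shows "\<exists>!h. frame_hom h \<and> (\<forall>g. h (\<phi> (generator R g)) = f g)"
proof -
  let ?p = "\<phi> \<circ> proj R"
  have hom: "frame_hom ?p" using iso by (simp add: presentation_iso_def)
  have bij: "bij_betw \<phi> (presented_frame R) UNIV" using iso by (simp add: presentation_iso_def)
  have range: "range (proj R) = presented_frame R"
    by (auto simp: presented_frame_def proj_def quotient_def)
  have surj: "\<exists>u. ?p u = x" for x
  proof -
    have "x \<in> \<phi> ` range (proj R)" using bij by (simp add: bij_betw_def range)
    then show ?thesis by auto
  qed
  have ker: "?p u = ?p v \<longleftrightarrow> (u, v) \<in> generated_congruence R" for u v
  proof -
    have "inj_on \<phi> (range (proj R))" using bij by (simp add: bij_betw_def range)
    then show ?thesis using inj_on_eq_iff[OF _ rangeI rangeI, of \<phi> "proj R" u v] by (simp add: proj_eq_iff)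
  qed
  define E where "E = {(u, v). extend f u = extend f v}"
  have E: "generated_congruence R \<subseteq> E"
  proof (rule generated_congruence_least)
    show "frame_congruence E" unfolding E_def by (rule frame_congruence_kernel[OF frame_hom_extend])
    fix r assume "r \<in> R"
    then have r: "satisfies f r" by (rule f)
    show "imposes E r"
    proof (cases r)
      case (Equal a b)
      then show ?thesis using r by (simp add: E_def)
    next
      case (Below a b)
      then show ?thesis
        using r frame_hom_extend[of f] by (simp add: E_def frame_hom_def inf_absorb1)
    qed
  qed
  define s where "s x = (SOME u. ?p u = x)" for x
  have s: "?p (s x) = x" for x unfolding s_def using surj by (rule someI_ex)
  have sp: "extend f (s (?p u)) = extend f u" for u
    using E s[of "?p u"] ker by (auto simp: E_def)
  have ext_hom: "frame_hom (extend f)" by (rule frame_hom_extend)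
  define h where "h x = extend f (s x)" for x
  have hp: "h (?p u) = extend f u" for u by (simp only: h_def sp)
  show ?thesis
  proof
    have "h top = top" using hp[of top] hom ext_hom by (simp add: frame_hom_def)
    moreover have "h (inf a b) = inf (h a) (h b)" for a b
      using hp[of "inf (s a) (s b)"] hom ext_hom s[of a] s[of b] by (simp add: frame_hom_def h_def)
    moreover have "h (Sup A) = Sup (h ` A)" for A
    proof -
      have "?p (Sup (s ` A)) = Sup (?p ` s ` A)" using hom unfolding frame_hom_def by blast
      also have "?p ` s ` A = A" unfolding image_image s by simp
      finally have "h (Sup A) = extend f (Sup (s ` A))" using hp[of "Sup (s ` A)"] by simp
      also have "\<dots> = Sup (h ` A)" using ext_hom by (simp add: frame_hom_def h_def image_image)
      finally show ?thesis .
    qed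
    ultimately show "frame_hom h \<and> (\<forall>g. h (\<phi> (generator R g)) = f g)"
      using hp[of "gen g" for g] by (simp add: frame_hom_def generator_def extend_gen)
  next
    fix k :: "'l \<Rightarrow> 'm"
    assume k: "frame_hom k \<and> (\<forall>g. k (\<phi> (generator R g)) = f g)"
    then have "frame_hom (k \<circ> ?p)" using hom by (intro frame_hom_comp) auto
    moreover have "\<forall>g. (k \<circ> ?p) (gen g) = f g" using k by (simp add: generator_def)
    ultimately have "k \<circ> ?p = extend f" by (intro extend_unique) auto
    then have "k (?p (s x)) = h x" for x unfolding h_def by (metis comp_apply)
    then have "k x = h x" for x by (simp only: s)
    then show "k = h" by (rule HOL.ext)
  qed
qed

text \<open>A pair \<open>(A, B)\<close> of sets of generators stands for the formal relation \<open>\<Or>A \<le> \<Or>B\<close>.\<close>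

type_synonym 'g join_relation = "'g set \<times> 'g set"

definition join_relations :: "'g join_relation set \<Rightarrow> 'g free_frame formal_relation set" where
  "join_relations R = {Below (SUP a\<in>A. gen a) (SUP b\<in>B. gen b) | A B. (A, B) \<in> R}"

definition sup_type :: "'g::semilattice_inf join_relation set \<Rightarrow> bool" where
  "sup_type R \<longleftrightarrow>
     (\<forall>A B c. (A, B) \<in> R \<longrightarrow> ((\<lambda>a. inf a c) ` A, (\<lambda>b. inf b c) ` B) \<in> R)"

definition semilattice_relations ::
  "'g::bounded_semilattice_inf_top itself \<Rightarrow> 'g free_frame formal_relation set" where
  "semilattice_relations _ =
     {Equal (gen top) top} \<union> {Equal (gen (inf s t)) (inf (gen s) (gen t)) | s t. True}"

text \<open>
  \<open>\<langle>G \<and>-semilattice | R\<rangle>\<close> is presented over the free frame on the underlying set of \<open>G\<close>,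
  adding relations which make the finite meets of \<open>G\<close>, including the empty one, agree with those
  of the frame.
\<close>

definition semilattice_presentation ::
  "'g::bounded_semilattice_inf_top join_relation set \<Rightarrow> 'g free_frame formal_relation set" where
  "semilattice_presentation R = semilattice_relations TYPE('g) \<union> join_relations R"

text \<open>
  Here \<^term>\<open>gen g\<close> plays the role of \<open>\<diamond>g\<close>, and \<open>rep t\<close> is the set of the \<open>t\<^sub>\<beta>\<close> in the chosen
  representation \<open>q\<^sup>*q\<^sub>!(t) = \<Or>\<^sub>\<beta> t\<^sub>\<beta>\<close>. The meets \<open>inf s u\<close> under \<^const>\<open>gen\<close> are those of \<open>G\<close>.
\<close>

definition diamond_presentation ::
  "'g::bounded_semilattice_inf_top join_relation set \<Rightarrow> ('g \<Rightarrow> 'g set) \<Rightarrow>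
     'g free_frame formal_relation set" where
  "diamond_presentation R rep =
     join_relations R \<union> {Equal (gen top) top} \<union>
     {Equal (inf (gen s) (gen t)) (SUP u\<in>rep t. gen (inf s u)) | s t. True}"

end

theory Submission
  imports Defs
begin

text \<open>
  For a \<open>Sup\<close>-type presentation, \<open>s \<le> \<Or>U\<close> holds in \<open>\<O>X\<close> only if \<open>s\<close> is obtained from the
  lower set of \<open>U\<close> by the rules ``if \<open>(A, B) \<in> R\<close> and \<open>B\<close> is derivable then so is \<open>A\<close>''. Now let
  \<open>F\<close> be the frame with the generators \<open>\<diamond>g\<close>, which maps onto \<open>\<O>Y\<close> by \<open>\<diamond>g \<mapsto> q\<^sub>!(g)\<close>; its
  relations make every element a join of generators. If \<open>q\<^sub>!(\<Or>S) \<le> q\<^sub>!(\<Or>T)\<close>, then each \<open>s \<in> S\<close>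
  lies below \<open>q\<^sup>*q\<^sub>!(\<Or>T) = \<Or>\<^sub>t\<Or>\<^sub>\<beta> t\<^sub>\<beta>\<close>, so it is derivable from elements \<open>g \<le> t\<^sub>\<beta>\<close>. Each of
  these satisfies \<open>\<diamond>g = \<diamond>(g \<and> t\<^sub>\<beta>) \<le> \<diamond>t\<close>, and the rules preserve the property
  \<open>\<diamond>g \<le> \<Or>\<^sub>t \<diamond>t\<close>. Hence the map is injective. Monotonicity of \<open>\<diamond>\<close>, which is not among the
  relations, is never needed.
\<close>

subsection \<open>Derivability from a \<open>Sup\<close>-type presentation\<close>

text \<open>The least set containing \<open>D\<close> that is closed under reading every relation of
  \<open>R\<close> from right to left. Lower sets are not built in; for \<open>Sup\<close>-type
  \<open>R\<close> and a lower set \<open>D\<close> the result is one by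
  \<open>join_closure_downward\<close>.\<close>

inductive_set join_closure :: "'g join_relation set \<Rightarrow> 'g set \<Rightarrow> 'g set"
  for R :: "'g join_relation set" and D :: "'g set" where
  base: "g \<in> D \<Longrightarrow> g \<in> join_closure R D"
| step: "(A, B) \<in> R \<Longrightarrow> \<forall>b\<in>B. b \<in> join_closure R D \<Longrightarrow> a \<in> A \<Longrightarrow> a \<in> join_closure R D"

lemma join_closure_least:
  assumes "D \<subseteq> J" and "\<And>A B. (A, B) \<in> R \<Longrightarrow> B \<subseteq> J \<Longrightarrow> A \<subseteq> J"
  shows "join_closure R D \<subseteq> J"
proof
  fix g assume "g \<in> join_closure R D"
  then show "g \<in> J" by induction (use assms in blast)+
qed

lemma join_closure_bind: "D \<subseteq> join_closure R D' \<Longrightarrow> join_closure R D \<subseteq> join_closure R D'"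
  by (rule join_closure_least) (auto intro: join_closure.step)

lemma join_closure_mono: "D \<subseteq> D' \<Longrightarrow> join_closure R D \<subseteq> join_closure R D'"
  by (rule join_closure_bind) (auto intro: join_closure.base)

text \<open>A derivation of \<open>g\<close> can be met with \<open>c\<close> throughout: stability
  of \<open>R\<close> under such meets turns every rule used into another rule of \<open>R\<close>,
  so only the leaves remain to be checked.\<close>

lemma join_closure_inf:
  assumes "sup_type R" "g \<in> join_closure R D"
    and "\<And>d. d \<in> D \<Longrightarrow> inf d c \<in> join_closure R D'"
  shows "inf g c \<in> join_closure R D'"
  using assms(2)
proof induction
  case (base g)
  then show ?case by (rule assms(3))
next
  case (step A B a)
  have "((\<lambda>a. inf a c) ` A, (\<lambda>b. inf b c) ` B) \<in> R"
    using assms(1) step.hyps(1) unfolding sup_type_def by blast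
  then show ?case
    by (rule join_closure.step) (use step in auto)
qed

lemma join_closure_downward:
  assumes "sup_type R" "\<And>d e. d \<in> D \<Longrightarrow> e \<le> d \<Longrightarrow> e \<in> D" "g \<in> join_closure R D" "h \<le> g"
  shows "h \<in> join_closure R D"
proof -
  have "inf g h \<in> join_closure R D"
    using assms(1,3) by (rule join_closure_inf) (meson assms(2) inf_le1 join_closure.base)
  then show ?thesis using assms(4) by (simp add: inf.absorb2)
qed

text \<open>This makes the closure commute with binary meets of lower sets, which is what turns its
  kernel into a frame congruence.\<close>

lemma join_closure_Int:
  assumes "sup_type R"
    and D: "\<And>d e. d \<in> D \<Longrightarrow> e \<le> d \<Longrightarrow> e \<in> D" and D': "\<And>d e. d \<in> D' \<Longrightarrow> e \<le> d \<Longrightarrow> e \<in> D'"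
  shows "join_closure R (D \<inter> D') = join_closure R D \<inter> join_closure R D'"
proof
  show "join_closure R (D \<inter> D') \<subseteq> join_closure R D \<inter> join_closure R D'"
    by (simp add: join_closure_mono)
  show "join_closure R D \<inter> join_closure R D' \<subseteq> join_closure R (D \<inter> D')"
  proof
    fix g assume g: "g \<in> join_closure R D \<inter> join_closure R D'"
    \<comment> \<open>First a derivation of \<open>g\<close> from \<open>D'\<close> is met with
      \<open>d\<close>; its leaves \<open>inf e d\<close> lie below elements of both sets.\<close>
    have "inf g d \<in> join_closure R (D \<inter> D')" if "d \<in> D" for d
    proof (rule join_closure_inf[OF assms(1), of _ D'])
      show "g \<in> join_closure R D'" using g by simp
      fix e assume "e \<in> D'"
      then have "inf e d \<in> D \<inter> D'" using D[OF that] D' by auto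
      then show "inf e d \<in> join_closure R (D \<inter> D')" by (rule join_closure.base)
    qed
    \<comment> \<open>Next a derivation of \<open>g\<close> from \<open>D\<close> is met with
      \<open>g\<close> itself, and its leaves are covered by the previous step.\<close>
    then have "inf g g \<in> join_closure R (D \<inter> D')"
      by (intro join_closure_inf[OF assms(1), of g D]) (use g in \<open>auto simp: inf.commute\<close>)
    then show "g \<in> join_closure R (D \<inter> D')" by simp
  qed
qed

section \<open>The closure as a congruence on the free frame\<close>

definition lower_set :: "'g::order free_frame \<Rightarrow> 'g set" where
  "lower_set u = {g. \<exists>A\<in>downset u. \<forall>a\<in>fset A. g \<le> a}"

text \<open>An element of the free frame is a join of finite meets of generators;
  \<open>lower_set\<close> evaluates those meets in \<open>G\<close> and collects what lies below
  one of them.\<close>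

lemma lower_set_downward: "d \<in> lower_set u \<Longrightarrow> e \<le> d \<Longrightarrow> e \<in> lower_set u"
  unfolding lower_set_def by (blast intro: order_trans)

lemma lower_set_inf: "lower_set (inf u v) = lower_set u \<inter> lower_set v"
proof
  show "lower_set u \<inter> lower_set v \<subseteq> lower_set (inf u v)"
  proof
    fix g assume "g \<in> lower_set u \<inter> lower_set v"
    then obtain A B where AB: "A \<in> downset u" "B \<in> downset v" "\<forall>a\<in>fset A \<union> fset B. g \<le> a"
      unfolding lower_set_def by auto
    then have "A |\<union>| B \<in> downset (inf u v)"
      by (auto simp: downset_simps intro: downset_mono)
    with AB(3) show "g \<in> lower_set (inf u v)"
      unfolding lower_set_def by (auto intro!: bexI[of _ "A |\<union>| B"])
  qed
qed (auto simp: lower_set_def downset_simps)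

lemma lower_set_Sup: "lower_set (Sup S) = (\<Union>u\<in>S. lower_set u)"
  by (auto simp: lower_set_def downset_simps)

lemma lower_set_gen: "lower_set (gen g) = {..g}"
  by (auto simp: lower_set_def downset_simps intro!: bexI[of _ "{|g|}"])

lemma lower_set_top: "lower_set top = UNIV"
  by (auto simp: lower_set_def downset_simps intro!: bexI[of _ "{||}"])

text \<open>Meets are respected by \<open>join_closure_Int\<close>. Joins are respected because the
  closure of a union depends only on the closures of its members.\<close>

lemma frame_congruence_join_closure:
  assumes "sup_type R"
  shows "frame_congruence {(u, v). join_closure R (lower_set u) = join_closure R (lower_set v)}"
    (is "frame_congruence ?E")
proof -
  have "equiv UNIV ?E" by (rule equivI) (auto simp: refl_on_def sym_on_def trans_on_def)
  moreover have "(inf a c, inf b d) \<in> ?E" if "(a, b) \<in> ?E" "(c, d) \<in> ?E" for a b c d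
    using that
    by (simp add: lower_set_inf join_closure_Int[OF assms lower_set_downward lower_set_downward])
  moreover have "(Sup (fst ` P), Sup (snd ` P)) \<in> ?E" if "P \<subseteq> ?E" for P
  proof -
    have P: "join_closure R (lower_set (fst p)) = join_closure R (lower_set (snd p))"
      if "p \<in> P" for p
      using that \<open>P \<subseteq> ?E\<close> by auto
    have sub: "join_closure R (lower_set (f p)) \<subseteq> join_closure R (\<Union>p\<in>P. lower_set (f p))"
      if "p \<in> P" for p and f :: "'a free_frame \<times> 'a free_frame \<Rightarrow> 'a free_frame"
      by (rule join_closure_mono) (use that in blast)
    have "(\<Union>p\<in>P. lower_set (fst p)) \<subseteq> join_closure R (\<Union>p\<in>P. lower_set (snd p))"
      using P sub[of _ snd] by (blast intro: join_closure.base)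
    moreover have "(\<Union>p\<in>P. lower_set (snd p)) \<subseteq> join_closure R (\<Union>p\<in>P. lower_set (fst p))"
      using P sub[of _ fst] by (blast intro: join_closure.base)
    ultimately show ?thesis
      by (simp add: lower_set_Sup image_image join_closure_bind subset_antisym)
  qed
  ultimately show ?thesis unfolding frame_congruence_def by blast
qed

text \<open>The closure congruence imposes all relations of the presentation, hence contains the
  generated one. This bounds from above what is identified in the presented frame.\<close>

lemma semilattice_presentation_join_closure:
  assumes "sup_type R" "(u, v) \<in> generated_congruence (semilattice_presentation R)"
  shows "join_closure R (lower_set u) = join_closure R (lower_set v)"
proof -
  let ?E = "{(u, v). join_closure R (lower_set u) = join_closure R (lower_set v)}"
  have "generated_congruence (semilattice_presentation R) \<subseteq> ?E"
  proof (rule generated_congruence_least[OF frame_congruence_join_closure[OF assms(1)]])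
    fix r assume "r \<in> semilattice_presentation R"
    then consider "r = Equal (gen top) top"
      | s t where "r = Equal (gen (inf s t)) (inf (gen s) (gen t))"
      | A B where "r = Below (SUP a\<in>A. gen a) (SUP b\<in>B. gen b)" "(A, B) \<in> R"
      unfolding semilattice_presentation_def semilattice_relations_def join_relations_def by blast
    then show "imposes ?E r"
    proof cases
      case 1
      have "{..top :: 'a} = UNIV" by auto
      with 1 show ?thesis by (simp add: lower_set_gen lower_set_top)
    next
      case 2
      have "{..inf s t} = {..s} \<inter> {..t}" by auto
      with 2 show ?thesis by (simp add: lower_set_gen lower_set_inf)
    next
      case 3
      let ?U = "\<lambda>A. SUP a\<in>A. gen a"
      have A: "a \<in> join_closure R (lower_set (?U B))" if "a \<in> A" for a
        using 3(2) _ that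
        by (rule join_closure.step)
          (auto simp: lower_set_Sup lower_set_gen intro: join_closure.base)
      \<comment> \<open>The rule for \<open>(A, B)\<close> yields only the members of
        \<open>A\<close>, while the lower set of the join also contains everything below
        them.\<close>
      have "x \<in> join_closure R (lower_set (?U B))" if "a \<in> A" "x \<le> a" for a x
        using assms(1) lower_set_downward A[OF that(1)] that(2) by (rule join_closure_downward)
      then have "lower_set (?U A) \<subseteq> join_closure R (lower_set (?U B))"
        unfolding lower_set_Sup[of "gen ` A"] by (auto simp: lower_set_gen)
      then have "join_closure R (lower_set (?U A)) \<subseteq> join_closure R (lower_set (?U B))"
        by (rule join_closure_bind)
      then have "join_closure R (lower_set (inf (?U A) (?U B))) = join_closure R (lower_set (?U A))"
        by (simp only: lower_set_inf Int_absorb2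
            join_closure_Int[OF assms(1) lower_set_downward lower_set_downward])
      with 3(1) show ?thesis by simp
    qed
  qed
  with assms(2) show ?thesis by blast
qed

subsection \<open>Presentations and surjective homomorphisms\<close>

lemma presentation_iso_kernel:
  assumes "presentation_iso R \<phi>"
  shows "\<phi> (proj R u) = \<phi> (proj R v) \<longleftrightarrow> (u, v) \<in> generated_congruence R"
proof -
  have "proj R w \<in> presented_frame R" for w
    by (simp add: proj_def presented_frame_def quotientI)
  moreover have "inj_on \<phi> (presented_frame R)"
    using assms unfolding presentation_iso_def bij_betw_def by blast
  ultimately show ?thesis by (simp only: inj_on_eq_iff proj_eq_iff)
qed

text \<open>The first isomorphism theorem: \<open>h\<close> is constant on the classes of its
  kernel, so evaluating it at a chosen representative gives a bijection.\<close>

lemma presentation_isoI: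
  fixes h :: "'g free_frame \<Rightarrow> 'l::frame"
  assumes "frame_hom h" "surj h" "\<And>u v. h u = h v \<longleftrightarrow> (u, v) \<in> generated_congruence R"
  shows "\<exists>\<psi> :: 'g free_frame set \<Rightarrow> 'l. presentation_iso R \<psi>"
proof -
  define \<psi> where "\<psi> C = h (SOME u. proj R u = C)" for C
  have \<psi>: "\<psi> (proj R u) = h u" for u
  proof -
    have "proj R (SOME v. proj R v = proj R u) = proj R u" by (rule someI) simp
    then show ?thesis unfolding \<psi>_def by (simp add: assms(3) flip: proj_eq_iff)
  qed
  have range: "presented_frame R = range (proj R)"
    by (auto simp: presented_frame_def proj_def quotient_def)
  have "inj_on \<psi> (presented_frame R)"
    unfolding range by (auto simp: inj_on_def \<psi> assms(3) proj_eq_iff)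
  moreover have "\<psi> ` presented_frame R = UNIV"
    unfolding range image_image \<psi> by (rule assms(2))
  moreover have "\<psi> \<circ> proj R = h" by (auto simp: \<psi>)
  ultimately have "presentation_iso R \<psi>"
    using assms(1) unfolding presentation_iso_def bij_betw_def by simp
  then show ?thesis by blast
qed

lemma generated_congruence_subset_kernel:
  assumes "\<And>r. r \<in> R \<Longrightarrow> satisfies f r" "(u, v) \<in> generated_congruence R"
  shows "extend f u = extend f v"
proof -
  have "generated_congruence R \<subseteq> {(u, v). extend f u = extend f v}"
  proof (rule generated_congruence_least[OF frame_congruence_kernel[OF frame_hom_extend]])
    fix r assume "r \<in> R"
    then have "satisfies f r" by (rule assms(1))
    then show "imposes {(u, v). extend f u = extend f v} r"
      using frame_hom_extend[of f] by (cases r) (simp_all add: frame_hom_def inf_absorb1)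
  qed
  with assms(2) show ?thesis by blast
qed

lemma extend_SUP_gen: "extend f (SUP g\<in>S. gen g) = (SUP g\<in>S. f g)"
  using frame_hom_extend[of f] by (simp add: frame_hom_def image_image extend_gen)

section \<open>The order of a presented frame, expressed on representatives\<close>

context
  fixes R :: "'g free_frame formal_relation set"
begin

lemma proj_inf: "proj R u = proj R u' \<Longrightarrow> proj R v = proj R v' \<Longrightarrow>
    proj R (inf u v) = proj R (inf u' v')"
  using frame_congruence_generated[of R] unfolding proj_eq_iff frame_congruence_def by blast

lemma proj_SUP:
  assumes "\<And>i. i \<in> I \<Longrightarrow> proj R (f i) = proj R (g i)"
  shows "proj R (SUP i\<in>I. f i) = proj R (SUP i\<in>I. g i)"
proof -
  have "(\<lambda>i. (f i, g i)) ` I \<subseteq> generated_congruence R"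
    using assms by (auto simp: proj_eq_iff)
  then have "(Sup (fst ` (\<lambda>i. (f i, g i)) ` I), Sup (snd ` (\<lambda>i. (f i, g i)) ` I))
      \<in> generated_congruence R"
    using frame_congruence_generated[of R] unfolding frame_congruence_def by blast
  then show ?thesis by (simp add: proj_eq_iff image_image)
qed

lemma proj_Equal: "Equal u v \<in> R \<Longrightarrow> proj R u = proj R v"
  using imposes_generated[of "Equal u v" R] by (simp add: proj_eq_iff)

definition proj_le :: "'g free_frame \<Rightarrow> 'g free_frame \<Rightarrow> bool" where
  "proj_le u v \<longleftrightarrow> proj R (inf u v) = proj R u"

lemma proj_le_Below: "Below u v \<in> R \<Longrightarrow> proj_le u v"
  using imposes_generated[of "Below u v" R] by (simp add: proj_eq_iff proj_le_def)

lemma proj_le_of_le: "u \<le> v \<Longrightarrow> proj_le u v"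
  by (simp add: proj_le_def inf_absorb1)

lemma proj_le_trans:
  assumes "proj_le u v" "proj_le v w" shows "proj_le u w"
proof -
  have "proj R (inf u w) = proj R (inf (inf u v) w)"
    using assms(1) by (intro proj_inf) (simp_all add: proj_le_def)
  also have "\<dots> = proj R (inf u (inf v w))" by (simp add: inf_assoc)
  also have "\<dots> = proj R (inf u v)" using assms(2) by (intro proj_inf) (simp_all add: proj_le_def)
  also have "\<dots> = proj R u" using assms(1) by (simp add: proj_le_def)
  finally show ?thesis by (simp add: proj_le_def)
qed

lemma proj_le_antisym: "proj_le u v \<Longrightarrow> proj_le v u \<Longrightarrow> proj R u = proj R v"
  by (simp add: proj_le_def inf.commute)

lemma proj_le_of_eq: "proj R u = proj R v \<Longrightarrow> proj_le u v"
  using proj_inf[of u v v v] by (simp add: proj_le_def)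

lemma proj_le_SUP:
  assumes "\<And>i. i \<in> I \<Longrightarrow> proj_le (f i) v" shows "proj_le (SUP i\<in>I. f i) v"
proof -
  have "inf (SUP i\<in>I. f i) v = (SUP i\<in>I. inf (f i) v)"
    by (simp add: inf.commute[of _ v] frame_inf_Sup image_image)
  then show ?thesis
    using proj_SUP[of I "\<lambda>i. inf (f i) v" f] assms by (simp add: proj_le_def)
qed

end

subsection \<open>The diamond presentation\<close>

text \<open>The relation for the meet of two generators rewrites it as a join of generators, and the
  relation for \<open>top\<close> handles the empty meet. Induction and distributivity then remove
  all finite meets.\<close>

lemma diamond_normal_form:
  fixes R :: "'g::bounded_semilattice_inf_top join_relation set" and rep :: "'g \<Rightarrow> 'g set"
  defines "Q \<equiv> diamond_presentation R rep"
  shows "\<exists>S. proj Q u = proj Q (SUP g\<in>S. gen g)"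
proof -
  have INF: "\<exists>S. proj Q (INF g\<in>A. gen g) = proj Q (SUP g\<in>S. gen g)" if "finite A" for A
    using that
  proof induction
    case empty
    have "proj Q (gen top) = proj Q top"
      by (rule proj_Equal) (simp add: Q_def diamond_presentation_def)
    then show ?case by (intro exI[of _ "{top}"]) simp
  next
    case (insert s A)
    then obtain S where S: "proj Q (INF g\<in>A. gen g) = proj Q (SUP g\<in>S. gen g)" by blast
    have "proj Q (INF g\<in>insert s A. gen g) = proj Q (inf (gen s) (SUP g\<in>S. gen g))"
      using proj_inf[OF refl S, of "gen s"] by simp
    also have "\<dots> = proj Q (SUP t\<in>S. inf (gen s) (gen t))"
      by (simp add: frame_inf_Sup image_image)
    also have "\<dots> = proj Q (SUP t\<in>S. SUP u\<in>rep t. gen (inf s u))"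
      by (intro proj_SUP proj_Equal) (auto simp: Q_def diamond_presentation_def)
    also have "(SUP t\<in>S. SUP u\<in>rep t. gen (inf s u)) = (SUP g\<in>(\<Union>t\<in>S. inf s ` rep t). gen g)"
      by (simp add: SUP_UNION image_image)
    finally show ?case by blast
  qed
  define S where "S A = (SOME S. proj Q (INF g\<in>fset A. gen g) = proj Q (SUP g\<in>S. gen g))" for A
  have S: "proj Q (INF g\<in>fset A. gen g) = proj Q (SUP g\<in>S A. gen g)" for A
    unfolding S_def by (rule someI_ex) (rule INF, simp)
  have "proj Q u = proj Q (SUP A\<in>downset u. INF g\<in>fset A. gen g)"
    using free_frame_normal_form[of u] by simp
  also have "\<dots> = proj Q (SUP A\<in>downset u. SUP g\<in>S A. gen g)"
    by (rule proj_SUP) (rule S)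
  also have "(SUP A\<in>downset u. SUP g\<in>S A. gen g) = (SUP g\<in>(\<Union>A\<in>downset u. S A). gen g)"
    by (simp add: SUP_UNION)
  finally show ?thesis by blast
qed

lemma diamond_join_closure:
  fixes R :: "'g::bounded_semilattice_inf_top join_relation set" and rep :: "'g \<Rightarrow> 'g set"
  defines "Q \<equiv> diamond_presentation R rep"
  assumes "g \<in> join_closure R {g. \<exists>t\<in>T. \<exists>u\<in>rep t. g \<le> u}"
  shows "proj_le Q (gen g) (SUP t\<in>T. gen t)"
proof -
  let ?v = "SUP t\<in>T. gen t"
  have "join_closure R {g. \<exists>t\<in>T. \<exists>u\<in>rep t. g \<le> u} \<subseteq> {g. proj_le Q (gen g) ?v}"
  proof (rule join_closure_least; clarify)
    fix g t u assume tu: "t \<in> T" "u \<in> rep t" "g \<le> u"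
    \<comment> \<open>Since \<open>g\<close> lies below \<open>u\<close>, \<open>inf g u\<close> is
      \<open>g\<close>, so \<open>gen g\<close> is itself a joinand; the whole join equals
      \<open>inf (gen g) (gen t)\<close> in the quotient.\<close>
    have "gen g \<le> (SUP u\<in>rep t. gen (inf g u))"
      using tu by (intro SUP_upper2[of u]) (simp_all add: inf_absorb1)
    then have "proj_le Q (gen g) (SUP u\<in>rep t. gen (inf g u))" by (rule proj_le_of_le)
    moreover have "proj_le Q (SUP u\<in>rep t. gen (inf g u)) (inf (gen g) (gen t))"
      by (rule proj_le_of_eq, rule proj_Equal[symmetric]) (auto simp: Q_def diamond_presentation_def)
    moreover have "proj_le Q (inf (gen g) (gen t)) ?v"
      using tu(1) by (intro proj_le_of_le le_infI2 SUP_upper)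
    ultimately show "proj_le Q (gen g) ?v" by (blast intro: proj_le_trans)
  next
    fix A B a assume AB: "(A, B) \<in> R" "B \<subseteq> {g. proj_le Q (gen g) ?v}" "a \<in> A"
    have "proj_le Q (gen a) (SUP a\<in>A. gen a)"
      using AB(3) by (intro proj_le_of_le SUP_upper)
    moreover have "proj_le Q (SUP a\<in>A. gen a) (SUP b\<in>B. gen b)"
      using AB(1) by (intro proj_le_Below)
        (auto simp: Q_def diamond_presentation_def join_relations_def)
    moreover have "proj_le Q (SUP b\<in>B. gen b) ?v"
      using AB(2) by (intro proj_le_SUP) blast
    ultimately show "proj_le Q (gen a) ?v" by (blast intro: proj_le_trans)
  qed
  with assms(2) show ?thesis by blast
qed

section \<open>The frame of the open quotient\<close>

lemma left_adjoint_Sup: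
  fixes l :: "'a::complete_lattice \<Rightarrow> 'b::complete_lattice"
  assumes "left_adjoint l r"
  shows "l (Sup A) = (SUP a\<in>A. l a)"
proof (rule order.antisym)
  have "Sup A \<le> r (SUP a\<in>A. l a)"
    using assms unfolding left_adjoint_def by (metis SUP_upper Sup_least)
  then show "l (Sup A) \<le> (SUP a\<in>A. l a)"
    using assms unfolding left_adjoint_def by blast
  have "a \<le> r (l (Sup A))" if "a \<in> A" for a
    using assms that unfolding left_adjoint_def by (metis Sup_upper order_refl order_trans)
  then show "(SUP a\<in>A. l a) \<le> l (Sup A)"
    using assms unfolding left_adjoint_def by (metis SUP_least)
qed

theorem corollary3p2:
  fixes R :: "'g::bounded_semilattice_inf_top join_relation set"
    and \<phi> :: "'g free_frame set \<Rightarrow> 'x::frame"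
    and \<eta> :: "'g \<Rightarrow> 'x"
    and q_star :: "'y::frame \<Rightarrow> 'x"
    and q_shriek :: "'x \<Rightarrow> 'y"
    and rep :: "'g \<Rightarrow> 'g set"
  assumes "sup_type R"
    and "presentation_iso (semilattice_presentation R) \<phi>"
    and "\<And>g. \<eta> g = \<phi> (generator (semilattice_presentation R) g)"
    and "open_quotient q_star q_shriek"
    and "\<And>t. q_star (q_shriek (\<eta> t)) = (SUP u\<in>rep t. \<eta> u)"
  shows "\<exists>\<psi> :: 'g free_frame set \<Rightarrow> 'y. presentation_iso (diamond_presentation R rep) \<psi>"
proof -
  let ?P = "semilattice_presentation R" and ?Q = "diamond_presentation R rep"
  let ?p = "\<phi> \<circ> proj ?P"
  have p: "frame_hom ?p" using assms(2) by (simp add: presentation_iso_def)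
  have "?p = extend \<eta>"
    by (rule extend_unique[OF p]) (simp add: assms(3) generator_def)
  then have ext_\<eta>: "extend \<eta> u = \<phi> (proj ?P u)" for u by (metis comp_apply)
  have \<eta>_sat: "satisfies \<eta> r" if "r \<in> ?P" for r
    using presentation_satisfies[OF assms(2) that] by (simp flip: assms(3))
  have \<eta>_top: "\<eta> top = top"
    using \<eta>_sat[of "Equal (gen top) top"] frame_hom_extend[of \<eta>]
    by (simp add: semilattice_presentation_def semilattice_relations_def extend_gen frame_hom_def)
  have \<eta>_inf: "\<eta> (inf s t) = inf (\<eta> s) (\<eta> t)" for s t
    using \<eta>_sat[of "Equal (gen (inf s t)) (inf (gen s) (gen t))"] frame_hom_extend[of \<eta>]
    by (auto simp: semilattice_presentation_def semilattice_relations_def extend_gen frame_hom_def)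
  have \<eta>_join: "(SUP a\<in>A. \<eta> a) \<le> (SUP b\<in>B. \<eta> b)" if "(A, B) \<in> R" for A B
    using \<eta>_sat[of "Below (SUP a\<in>A. gen a) (SUP b\<in>B. gen b)"] that
    by (auto simp: semilattice_presentation_def join_relations_def extend_SUP_gen)
  \<comment> \<open>An inequality is the identification of
    \<open>inf (gen s) (SUP u\<in>U. gen u)\<close> with \<open>gen s\<close>, so both have the same
    closure; that of \<open>gen s\<close> contains \<open>s\<close>.\<close>
  have coverage: "s \<in> join_closure R {g. \<exists>u\<in>U. g \<le> u}" if "\<eta> s \<le> (SUP u\<in>U. \<eta> u)" for s U
  proof -
    have "extend \<eta> (inf (gen s) (SUP u\<in>U. gen u)) = extend \<eta> (gen s)"
      using that frame_hom_extend[of \<eta>]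
      by (simp add: frame_hom_def extend_gen image_image inf_absorb1)
    then have "(inf (gen s) (SUP u\<in>U. gen u), gen s) \<in> generated_congruence ?P"
      unfolding ext_\<eta> presentation_iso_kernel[OF assms(2)] .
    then have "join_closure R (lower_set (inf (gen s) (SUP u\<in>U. gen u)))
        = join_closure R (lower_set (gen s))"
      by (rule semilattice_presentation_join_closure[OF assms(1)])
    moreover have "s \<in> join_closure R (lower_set (gen s))"
      by (rule join_closure.base) (simp add: lower_set_gen)
    moreover have "lower_set (inf (gen s) (SUP u\<in>U. gen u)) \<subseteq> {g. \<exists>u\<in>U. g \<le> u}"
      by (auto simp: lower_set_inf lower_set_Sup lower_set_gen)
    ultimately show ?thesis using join_closure_mono by blast
  qed
  have q: "frame_hom q_star" "left_adjoint q_shriek q_star" "inj q_star"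
    and frobenius: "\<And>a b. q_shriek (inf a (q_star b)) = inf (q_shriek a) b"
    using assms(4) by (auto simp: open_quotient_def open_map_def)
  have q_Sup: "q_shriek (SUP i\<in>I. f i) = (SUP i\<in>I. q_shriek (f i))" for I :: "'g set" and f
    using left_adjoint_Sup[OF q(2), of "f ` I"] by (simp add: image_image)
  have q_mono: "q_shriek a \<le> q_shriek b" if "a \<le> b" for a b
    using q(2) that unfolding left_adjoint_def by (meson order_refl order_trans)
  \<comment> \<open>Adjunction and Frobenius give
    \<open>q_star (q_shriek (q_star b)) = q_star b\<close>; injectivity of \<open>q_star\<close>
    cancels the outer map.\<close>
  have q_section: "q_shriek (q_star b) = b" for b
  proof -
    have "q_star (q_shriek (q_star b)) = q_star b"
    proof (rule order.antisym)
      have "inf (q_shriek (q_star b)) b = q_shriek (q_star b)"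
        using frobenius[of "q_star b" b] by simp
      then show "q_star (q_shriek (q_star b)) \<le> q_star b"
        using q(1) unfolding frame_hom_def by (metis inf.cobounded2)
      show "q_star b \<le> q_star (q_shriek (q_star b))"
        using q(2) unfolding left_adjoint_def by blast
    qed
    with q(3) show ?thesis by (simp add: inj_eq)
  qed
  define f where "f g = q_shriek (\<eta> g)" for g
  let ?h = "extend f"
  have f_sat: "satisfies f r" if "r \<in> ?Q" for r
  proof -
    from that consider "r = Equal (gen top) top"
      | s t where "r = Equal (inf (gen s) (gen t)) (SUP u\<in>rep t. gen (inf s u))"
      | A B where "r = Below (SUP a\<in>A. gen a) (SUP b\<in>B. gen b)" "(A, B) \<in> R"
      unfolding diamond_presentation_def join_relations_def by blast
    then show ?thesis
    proof cases
      case 1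
      have "q_shriek top = top" using q_section[of top] q(1) by (simp add: frame_hom_def)
      with 1 show ?thesis
        using frame_hom_extend[of f] by (simp add: extend_gen f_def \<eta>_top frame_hom_def)
    next
      case 2
      \<comment> \<open>Frobenius moves \<open>f t\<close> inside \<open>q_shriek\<close> as
        \<open>q_star (q_shriek (\<eta> t))\<close>, which is then replaced by its chosen
        representation.\<close>
      have "inf (f s) (f t) = q_shriek (inf (\<eta> s) (SUP u\<in>rep t. \<eta> u))"
        by (simp add: f_def assms(5) flip: frobenius)
      also have "\<dots> = q_shriek (SUP u\<in>rep t. \<eta> (inf s u))"
        by (simp add: frame_inf_Sup image_image \<eta>_inf)
      also have "\<dots> = (SUP u\<in>rep t. f (inf s u))" by (simp add: q_Sup f_def)
      finally show ?thesis
        using 2 frame_hom_extend[of f] by (simp add: frame_hom_def extend_gen image_image)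
    next
      case 3
      then show ?thesis
        using q_mono[OF \<eta>_join[OF 3(2)]] by (simp add: extend_SUP_gen f_def q_Sup)
    qed
  qed
  have le: "proj_le ?Q (SUP s\<in>S. gen s) (SUP t\<in>T. gen t)"
    if "(SUP s\<in>S. f s) \<le> (SUP t\<in>T. f t)" for S T
  proof (rule proj_le_SUP)
    fix s assume "s \<in> S"
    then have "f s \<le> (SUP t\<in>T. f t)" using that by (meson SUP_le_iff)
    \<comment> \<open>Transposing along the adjunction moves the comparison from the quotient to the
      presented frame, where \<open>coverage\<close> applies.\<close>
    then have "\<eta> s \<le> q_star (SUP t\<in>T. f t)"
      using q(2) unfolding left_adjoint_def f_def by blast
    also have "\<dots> = (SUP t\<in>T. SUP u\<in>rep t. \<eta> u)"
      using q(1) by (simp add: frame_hom_def image_image f_def assms(5))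
    also have "\<dots> = (SUP u\<in>(\<Union>t\<in>T. rep t). \<eta> u)" by (simp add: SUP_UNION)
    finally have "s \<in> join_closure R {g. \<exists>u\<in>(\<Union>t\<in>T. rep t). g \<le> u}" by (rule coverage)
    then show "proj_le ?Q (gen s) (SUP t\<in>T. gen t)"
      by (intro diamond_join_closure) simp
  qed
  show ?thesis
  proof (rule presentation_isoI[OF frame_hom_extend])
    show "surj ?h"
    proof (rule surjI)
      fix y
      \<comment> \<open>The image of \<open>\<eta>\<close> is closed under finite meets, so
        \<open>q_star y\<close> is a join of elements \<open>\<eta> g\<close>; applying
        \<open>q_shriek\<close> recovers \<open>y\<close> as a join of elements
        \<open>f g\<close>.\<close>
      have finite_INF: "\<exists>m. (INF g\<in>A. \<eta> g) = \<eta> m" if "finite A" for A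
        using that
      proof induction
        case empty
        then show ?case using \<eta>_top by (metis INF_empty)
      next
        case (insert s A)
        then show ?case using \<eta>_inf by (metis INF_insert)
      qed
      define m where "m A = (SOME m. (INF g\<in>fset A. \<eta> g) = \<eta> m)" for A
      have m: "(INF g\<in>fset A. \<eta> g) = \<eta> (m A)" for A
        unfolding m_def by (rule someI_ex) (simp add: finite_INF)
      have "q_star y \<in> \<phi> ` presented_frame ?P"
        using assms(2) by (simp add: presentation_iso_def bij_betw_def)
      then obtain u where "q_star y = extend \<eta> u"
        unfolding ext_\<eta> presented_frame_def proj_def quotient_def by auto
      also have "\<dots> = (SUP g\<in>m ` downset u. \<eta> g)"
        by (simp add: extend_def m image_image)
      finally have "y = (SUP g\<in>m ` downset u. f g)"
        using q_section[of y] q_Sup[of \<eta> "m ` downset u"] by (simp add: f_def)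
      then have "?h (SUP g\<in>m ` downset u. gen g) = y" by (simp only: extend_SUP_gen)
      then show "?h (SOME u. ?h u = y) = y" by (rule someI)
    qed
    fix u v
    show "?h u = ?h v \<longleftrightarrow> (u, v) \<in> generated_congruence ?Q"
    proof
      assume eq: "?h u = ?h v"
      obtain S T where S: "proj ?Q u = proj ?Q (SUP s\<in>S. gen s)"
        and T: "proj ?Q v = proj ?Q (SUP t\<in>T. gen t)"
        using diamond_normal_form by metis
      \<comment> \<open>Passing to normal forms does not change \<open>?h\<close>, because
        \<open>f\<close> satisfies the diamond relations. Then \<open>le\<close> applies in both
        directions.\<close>
      have "?h u = ?h (SUP s\<in>S. gen s)" "?h v = ?h (SUP t\<in>T. gen t)"
        using S T unfolding proj_eq_iff
        by (blast intro: generated_congruence_subset_kernel[OF f_sat])+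
      with eq have "(SUP s\<in>S. f s) = (SUP t\<in>T. f t)" by (simp only: extend_SUP_gen)
      then have "proj ?Q (SUP s\<in>S. gen s) = proj ?Q (SUP t\<in>T. gen t)"
        by (intro proj_le_antisym le) simp_all
      then have "proj ?Q u = proj ?Q v" by (simp only: S T)
      then show "(u, v) \<in> generated_congruence ?Q" by (simp only: proj_eq_iff)
    qed (rule generated_congruence_subset_kernel[OF f_sat])
  qed
qed

end
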